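(* Let $n\ge1$ and fix a Dyck path $\beta$ of length $2n+2$. The number of permutations $w\in\mathfrak{S}_{2n}$ with $p_B(w)=\beta$ equals \[1\cdot3\cdot5\cdots(2n-1)\prod_{i=1}^n h_i^*(\beta).\]
   Context: A Dyck path of length $2N$ is a lattice path from $(0,0)$ to $(2N,0)$ with steps $(1,1)$ (up) and $(1,-1)$ (down) staying weakly above the $x$-axis; the down step ending at $x$-coordinate $k$ and going from height $h$ to $h-1$ is at position $k$ with height $h$; the path is determined by its set of down-step positions. $h_i(p)$ is the height of the $i$th down step of $p$, and $h_i^*(p)=h_i(p)-1$ if there is no up step to the right of the $i$th down step, $h_i^*(p)=h_i(p)$ otherwise. Crossout procedure: for $w\in\mathfrak{S}_{2n}$ in one-line notation, repeat until all positions are marked: mark "B" at the unmarked position $i$ with smallest value $w(i)$, then mark "A" at the leftmost unmarked position. $\mathcal{B}(w)$ is the set of positions marked B. $p_B(w)$ is the Dyck path of length $2n+2$ whose down-step positions are $\{b+1:b\in\mathcal{B}(w)\}\cup\{2n+2\}$. *)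

theory Defs
  imports "HOL-Combinatorics.Permutations"
begin

datatype step = Up | Down

text \<open>A lattice path starting at the origin is the list of its steps; the step ending at
  x-coordinate \<open>k\<close> has list index \<open>k - 1\<close>.\<close>

definition path_height :: "step list \<Rightarrow> nat \<Rightarrow> int" where
  "path_height p k = (\<Sum>j<k. if p ! j = Up then 1 else - 1)"

definition dyck_path :: "nat \<Rightarrow> step list \<Rightarrow> bool" where
  "dyck_path N p \<longleftrightarrow>
     length p = 2 * N \<and> (\<forall>k\<le>2 * N. 0 \<le> path_height p k) \<and> path_height p (2 * N) = 0"

definition down_positions :: "step list \<Rightarrow> nat set" where
  "down_positions p = {k \<in> {1..length p}. p ! (k - 1) = Down}"

definition path_of_downs :: "nat \<Rightarrow> nat set \<Rightarrow> step list" where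
  "path_of_downs l D = map (\<lambda>k. if k \<in> D then Down else Up) [1..<l + 1]"

lemma length_path_of_downs [simp]: "length (path_of_downs l D) = l"
  by (simp add: path_of_downs_def)

lemma down_positions_path_of_downs:
  assumes "D \<subseteq> {1..l}"
  shows "down_positions (path_of_downs l D) = D"
proof -
  have "path_of_downs l D ! (k - 1) = (if k \<in> D then Down else Up)" if "k \<in> {1..l}" for k
    using that by (auto simp: path_of_downs_def simp del: upt_Suc)
  then show ?thesis
    using assms by (auto simp: down_positions_def split: if_splits)
qed

definition down_pos :: "step list \<Rightarrow> nat \<Rightarrow> nat" where
  "down_pos p i = sorted_list_of_set (down_positions p) ! (i - 1)"

definition down_height :: "step list \<Rightarrow> nat \<Rightarrow> int" where
  "down_height p i = path_height p (down_pos p i - 1)"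

definition down_height_star :: "step list \<Rightarrow> nat \<Rightarrow> int" where
  "down_height_star p i =
     (if \<exists>k\<in>{1..length p}. down_pos p i < k \<and> p ! (k - 1) = Up
      then down_height p i else down_height p i - 1)"

text \<open>\<open>crossout_B w U\<close> is the set of positions that receive the mark B when the crossout
  procedure is run from the state whose set of unmarked positions is \<open>U\<close>: one round marks
  B at \<open>arg_min_on w U\<close>, then A at the least remaining position.\<close>

function crossout_B :: "(nat \<Rightarrow> nat) \<Rightarrow> nat set \<Rightarrow> nat set" where
  "crossout_B w U =
     (if finite U \<and> U \<noteq> {} then
        let b = arg_min_on w U; a = Min (U - {b})
        in insert b (crossout_B w (U - {b, a}))
      else {})"
  by pat_completeness auto
termination
proof (relation "measure (\<lambda>(w, U). card U)", goal_cases)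
  case (2 w U b a)
  then have "b \<in> U"
    by (simp add: arg_min_if_finite)
  then show ?case
    using 2 by (auto intro!: psubset_card_mono)
qed simp

declare crossout_B.simps [simp del]

definition B_set :: "nat \<Rightarrow> (nat \<Rightarrow> nat) \<Rightarrow> nat set" where
  "B_set n w = crossout_B w {1..2 * n}"

definition p_B :: "nat \<Rightarrow> (nat \<Rightarrow> nat) \<Rightarrow> step list" where
  "p_B n w = path_of_downs (2 * n + 2) ((\<lambda>b. b + 1) ` B_set n w \<union> {2 * n + 2})"

end

theory Submission
  imports Defs "HOL-Combinatorics.Multiset_Permutations"
begin

text \<open>The first round of the crossout procedure marks some \<open>b\<close> with B and some \<open>a\<close> with A. Given \<open>b\<close>,
  the relative order of the other \<open>2n - 2\<close> positions is arbitrary and the value at \<open>a\<close> can be inserted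
  in \<open>2n - 1\<close> ways; this yields the double factorial, and leaves a sum over \<open>b\<close>.
  If the first position is marked B, then it has to be \<open>b\<close>, and deleting \<open>b\<close> and \<open>a\<close> does not change
  any other height. If not, then \<open>b\<close> is an arbitrary down step, and deleting the first up step and \<open>b\<close>
  lowers exactly the heights of the down steps before \<open>b\<close>. With \<open>x\<^sub>i = h\<^sub>i\<^sup>*\<close>, the sum over \<open>j\<close> of
  \<open>\<Prod>\<^bsub>i<j\<^esub> (x\<^sub>i - 1) \<Prod>\<^bsub>i>j\<^esub> x\<^sub>i\<close> telescopes to \<open>\<Prod> x\<^sub>i - \<Prod> (x\<^sub>i - 1)\<close>, and the last product
  vanishes because some starred height is 1. Sets of down steps that cross below the axis need no
  separate treatment: both sides are then 0.\<close>

section \<open>Crossing out a list of positions\<close>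

function crossout_list :: "nat list \<Rightarrow> nat set" where
  "crossout_list [] = {}"
| "crossout_list (b # zs) = insert b (crossout_list (remove1 (Min (set zs)) zs))"
  by pat_completeness auto
termination
  by (relation "measure length") (auto simp: length_remove1)

lemma crossout_list_subset: "crossout_list xs \<subseteq> set xs"
proof (induction xs rule: crossout_list.induct)
  case (2 b zs)
  then show ?case
    using set_remove1_subset[of "Min (set zs)" zs] by auto
qed simp

lemma sorted_wrt_remove1: "sorted_wrt P xs \<Longrightarrow> sorted_wrt P (remove1 x xs)"
  by (induction xs) (auto dest: set_remove1_subset[THEN subsetD])

text \<open>Sorting by value puts the minimizer of \<open>w\<close> at the head, and deleting
  entries keeps the list sorted.\<close>

lemma crossout_B_eq_crossout_list:
  assumes "sorted_wrt (\<lambda>x y. w x < w y) xs" "distinct xs"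
  shows "crossout_B w (set xs) = crossout_list xs"
  using assms
proof (induction xs rule: crossout_list.induct)
  case 1
  then show ?case by (simp add: crossout_B.simps)
next
  case (2 b zs)
  \<comment> \<open>Injectivity makes the minimizer unique, so the choice made by
    \<open>arg_min_on\<close> can only be \<open>b\<close>.\<close>
  have "inj_on w (set (b # zs))"
  proof (rule inj_onI)
    fix x y assume "x \<in> set (b # zs)" "y \<in> set (b # zs)" "w x = w y"
    then obtain i j where ij: "i < length (b # zs)" "j < length (b # zs)"
      "x = (b # zs) ! i" "y = (b # zs) ! j" "w ((b # zs) ! i) = w ((b # zs) ! j)"
      by (metis in_set_conv_nth)
    then show "x = y"
      using 2(2) sorted_wrt_iff_nth_less[of "\<lambda>x y. w x < w y" "b # zs"]
      by (metis less_irrefl linorder_neqE_nat)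
  qed
  then have b: "arg_min_on w (set (b # zs)) = b"
    unfolding arg_min_on_def using 2(2)
    by (intro arg_min_inj_eq) (simp_all only: Collect_mem_eq, auto intro: less_imp_le)
  have diff: "set (b # zs) - {b} = set zs"
    using 2(3) by auto
  have "set (b # zs) - {b, Min (set zs)} = set (remove1 (Min (set zs)) zs)"
    using 2(3) by auto
  moreover have "crossout_B w (set (remove1 (Min (set zs)) zs))
      = crossout_list (remove1 (Min (set zs)) zs)"
    using 2 by (auto intro: sorted_wrt_remove1)
  ultimately show ?case
    by (subst crossout_B.simps) (simp add: Let_def b diff del: set_simps)
qed

text \<open>Deleting \<open>a\<close> is undone by putting it back into any of the
  \<open>length ys + 1\<close> gaps of \<open>ys\<close>. This is the source of the odd
  factors.\<close>

lemma card_remove1_fibre: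
  assumes "finite V" "a \<in> V" "ys \<in> permutations_of_set (V - {a})"
  shows "card {zs \<in> permutations_of_set V. remove1 a zs = ys} = card V"
proof -
  let ?ins = "\<lambda>k. take k ys @ a # drop k ys"
  have ys: "set ys = V - {a}" "distinct ys"
    using assms by (auto simp: permutations_of_set_def)
  have len: "Suc (length ys) = card V"
    using ys assms by (metis card_Suc_Diff1 distinct_card)
  have "{zs \<in> permutations_of_set V. remove1 a zs = ys} = ?ins ` {..length ys}"
  proof (intro equalityI subsetI)
    fix zs assume "zs \<in> {zs \<in> permutations_of_set V. remove1 a zs = ys}"
    then have zs: "set zs = V" "distinct zs" "remove1 a zs = ys"
      by (auto simp: permutations_of_set_def)
    then obtain us vs where uv: "zs = us @ a # vs" "a \<notin> set us"
      using assms(2) by (metis split_list_first)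
    then have "ys = us @ vs"
      using zs by (auto simp: remove1_append)
    then show "zs \<in> ?ins ` {..length ys}"
      using uv by (intro image_eqI[of _ _ "length us"]) auto
  next
    fix zs assume "zs \<in> ?ins ` {..length ys}"
    then obtain k where k: "k \<le> length ys" "zs = ?ins k" by auto
    have "mset zs = add_mset a (mset ys)"
      using k by (metis append_take_drop_id mset.simps(2) mset_append union_mset_add_mset_right)
    then have "set zs = insert a (set ys)" "distinct zs"
      using ys by (metis set_mset_add_mset_insert set_mset_mset,
        metis Diff_iff distinct.simps(2) mset.simps(2) mset_eq_imp_distinct_iff singletonI)
    moreover have "a \<notin> set (take k ys)"
      using ys(1) set_take_subset[of k ys] by auto
    ultimately show "zs \<in> {zs \<in> permutations_of_set V. remove1 a zs = ys}"
      using ys k assms(2) by (auto simp: permutations_of_set_def remove1_append)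
  qed
  moreover have "inj_on ?ins {..length ys}"
  proof (rule inj_onI)
    fix k l assume kl: "k \<in> {..length ys}" "l \<in> {..length ys}" "?ins k = ?ins l"
    have "takeWhile (\<lambda>x. x \<noteq> a) (?ins j) = take j ys" for j
      using ys(1) set_take_subset[of j ys] by (subst takeWhile_append2) auto
    then have "take k ys = take l ys"
      using kl(3) by metis
    then show "k = l"
      using kl(1,2) by (metis atMost_iff length_take min.absorb2)
  qed
  ultimately show ?thesis
    using len by (simp add: card_image)
qed

section \<open>Counting orders by their set of B positions\<close>

definition crossout_count :: "nat set \<Rightarrow> nat set \<Rightarrow> nat" where
  "crossout_count U B = card {xs \<in> permutations_of_set U. crossout_list xs = B}"

text \<open>The lists are sorted by their head \<open>b\<close>, then by what is left of the tail
  once the position marked A is deleted; each remainder arises from \<open>card U - 1\<close> tails.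
  A position marked A never gets a B, hence the terms 0.\<close>

lemma crossout_count_rec:
  assumes "finite U" "B \<subseteq> U" "card U \<ge> 2"
  shows "crossout_count U B =
    (card U - 1) * (\<Sum>b\<in>B. if Min (U - {b}) \<in> B then 0
                          else crossout_count (U - {b, Min (U - {b})}) (B - {b}))"
proof -
  let ?a = "\<lambda>b. Min (U - {b})"
  let ?V = "\<lambda>b. U - {b, ?a b}"
  let ?S = "\<lambda>b. {zs \<in> permutations_of_set (U - {b}). crossout_list (b # zs) = B}"
  have ne: "U \<noteq> {}" using assms(3) by auto
  \<comment> \<open>The head of a list is always marked B, so the heads range over
    \<open>B\<close>.\<close>
  have split: "{xs \<in> permutations_of_set U. crossout_list xs = B} = (\<Union>b\<in>B. (#) b ` ?S b)"
    using assms(2) ne by (auto simp: permutations_of_set_nonempty simp del: crossout_list.simps)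
       (auto)
  have S: "card (?S b) = (card U - 1) * (if ?a b \<in> B then 0 else crossout_count (?V b) (B - {b}))"
    if b: "b \<in> B" for b
  proof -
    have bU: "b \<in> U" using b assms by auto
    have cardU: "card (U - {b}) = card U - 1"
      using bU assms(1) by simp
    then have "U - {b} \<noteq> {}"
      using assms(3) by (metis Suc_1 card.empty diff_is_0_eq not_less_eq_eq)
    then have a: "?a b \<in> U - {b}"
      using assms(1) by (intro Min_in) auto
    let ?T = "{ys \<in> permutations_of_set (?V b). insert b (crossout_list ys) = B}"
    have V: "U - {b} - {?a b} = ?V b" by auto
    have "card (?S b) = card (\<Union>ys\<in>?T. {zs \<in> permutations_of_set (U - {b}). remove1 (?a b) zs = ys})"
    proof -
      have cl: "crossout_list (b # zs) = insert b (crossout_list (remove1 (?a b) zs))"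
        and "remove1 (?a b) zs \<in> permutations_of_set (?V b)"
        if "zs \<in> permutations_of_set (U - {b})" for zs
        using that by (auto simp: permutations_of_set_def)
      then show ?thesis
        by (intro arg_cong[of _ _ card]) (blast intro: cl[THEN trans] dest: cl[THEN sym, THEN trans])
    qed
    also have "\<dots> = (\<Sum>ys\<in>?T. card {zs \<in> permutations_of_set (U - {b}). remove1 (?a b) zs = ys})"
      using assms(1) by (intro card_UN_disjoint) auto
    also have "\<dots> = (\<Sum>ys\<in>?T. card U - 1)"
    proof (intro sum.cong refl)
      fix ys assume "ys \<in> ?T"
      then have ys: "ys \<in> permutations_of_set (U - {b} - {?a b})"
        unfolding V by blast
      then show "card {zs \<in> permutations_of_set (U - {b}). remove1 (?a b) zs = ys} = card U - 1"
        using card_remove1_fibre[OF finite_Diff[OF assms(1)] a ys] cardU by argo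
    qed
    also have "\<dots> = (card U - 1) * card ?T" by simp
    also have "card ?T = (if ?a b \<in> B then 0 else crossout_count (?V b) (B - {b}))"
    proof -
      \<comment> \<open>Later marks avoid both \<open>b\<close> and \<open>?a b\<close>: the first
        lets \<open>insert b\<close> be cancelled, the second rules out \<open>?a b\<close> in
        \<open>B\<close>.\<close>
      have sub: "crossout_list ys \<subseteq> ?V b" if "ys \<in> permutations_of_set (?V b)" for ys
        using that crossout_list_subset[of ys] by (auto simp: permutations_of_set_def)
      show ?thesis
      proof (cases "?a b \<in> B")
        case True
        then have "?T = {}"
          using sub a by blast
        then show ?thesis using True by simp
      next
        case False
        have "?T = {ys \<in> permutations_of_set (?V b). crossout_list ys = B - {b}}"
          using sub b by blast
        then show ?thesis using False by (simp add: crossout_count_def)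
      qed
    qed
    finally show ?thesis .
  qed
  have "crossout_count U B = (\<Sum>b\<in>B. card ((#) b ` ?S b))"
    unfolding crossout_count_def split
    using assms finite_subset[OF assms(2,1)] by (intro card_UN_disjoint) auto
  also have "\<dots> = (\<Sum>b\<in>B. card (?S b))"
    by (intro sum.cong card_image) auto
  also have "\<dots> = (card U - 1) * (\<Sum>b\<in>B. if ?a b \<in> B then 0 else crossout_count (?V b) (B - {b}))"
    unfolding sum_distrib_left by (intro sum.cong refl S)
  finally show ?thesis .
qed

section \<open>Starred heights\<close>

text \<open>The lattice path with horizontal positions \<open>U\<close> and down steps \<open>B\<close>, started at height \<open>h\<close>.
  The path \<open>p_B n w\<close> without its first and last step is the case \<open>h = 1\<close>; other starting heights
  serve as induction parameter.\<close>

definition level :: "int \<Rightarrow> nat set \<Rightarrow> nat set \<Rightarrow> nat \<Rightarrow> int" where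
  "level h U B b = h + (\<Sum>u\<in>{u \<in> U. u < b}. if u \<in> B then - 1 else 1)"

definition star_level :: "int \<Rightarrow> nat set \<Rightarrow> nat set \<Rightarrow> nat \<Rightarrow> int" where
  "star_level h U B b = (if \<exists>u\<in>U - B. b < u then level h U B b else level h U B b - 1)"

lemma star_level_shift: "star_level (h + k) U B b = star_level h U B b + k"
  by (simp add: star_level_def level_def)

text \<open>The step at \<open>u\<close> precedes every other one, so it can be absorbed into the
  starting height, while \<open>u\<close> is never an up step to the right of
  \<open>b\<close>.\<close>

lemma star_level_insert_least:
  assumes "finite U" "\<And>x. x \<in> U \<Longrightarrow> u < x" "b \<in> U"
  shows "star_level h (insert u U) B b = star_level (if u \<in> B then h - 1 else h + 1) U (B - {u}) b"
proof -
  have u: "u \<notin> U" "u < b" using assms by auto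
  have "{x \<in> insert u U. x < b} = insert u {x \<in> U. x < b}" using u by auto
  moreover have "(\<Sum>x\<in>{x \<in> U. x < b}. if x \<in> B then - 1 else 1 :: int)
      = (\<Sum>x\<in>{x \<in> U. x < b}. if x \<in> B - {u} then - 1 else 1)"
    using u by (intro sum.cong) auto
  ultimately have "level h (insert u U) B b = level (if u \<in> B then h - 1 else h + 1) U (B - {u}) b"
    using u assms(1) by (simp add: level_def)
  moreover have "(\<exists>x\<in>insert u U - B. b < x) \<longleftrightarrow> (\<exists>x\<in>U - (B - {u}). b < x)"
    using u by auto
  ultimately show ?thesis
    by (simp add: star_level_def)
qed

text \<open>Without the down step at \<open>b\<close> the path after it runs one higher; the up
  steps, and with them the starring condition, stay the same.\<close>

lemma star_level_remove_down:
  assumes "finite U" "b \<in> B" "b \<in> U" "c \<noteq> b"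
  shows "star_level h (U - {b}) (B - {b}) c = star_level h U B c + (if b < c then 1 else 0)"
proof -
  have e: "(\<Sum>u\<in>A. if u \<in> B - {b} then - 1 else 1 :: int) = (\<Sum>u\<in>A. if u \<in> B then - 1 else 1)"
    if "b \<notin> A" for A
    using that by (intro sum.cong) auto
  have "level h (U - {b}) (B - {b}) c = level h U B c + (if b < c then 1 else 0)"
  proof (cases "b < c")
    case True
    then have "{u \<in> U. u < c} = insert b {u \<in> U - {b}. u < c}" using assms by auto
    then show ?thesis using True assms e[of "{u \<in> U - {b}. u < c}"] by (simp add: level_def)
  next
    case False
    then have "{u \<in> U - {b}. u < c} = {u \<in> U. u < c}" by auto
    then show ?thesis using False e[of "{u \<in> U. u < c}"] by (simp add: level_def)
  qed
  moreover have "U - {b} - (B - {b}) = U - B" using assms by auto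
  ultimately show ?thesis by (simp add: star_level_def)
qed

text \<open>If the last step is down, it leaves from height 1 with no up step after it. If it is up,
  the path comes from -1, so an earlier down step left from height 0. The induction instead follows
  the path from its start.\<close>

lemma exists_star_level_zero:
  assumes "finite U" "B \<subseteq> U" "h + (\<Sum>u\<in>U. if u \<in> B then - 1 else 1) = 0"
    and "h \<ge> 1 \<or> h = 0 \<and> U - B \<noteq> {}"
  shows "\<exists>b\<in>B. star_level h U B b = 0"
  using assms
proof (induction U arbitrary: B h rule: finite_linorder_min_induct)
  case empty
  then show ?case by auto
next
  case (insert u U)
  have u: "u \<notin> U" using insert by auto
  let ?h = "if u \<in> B then h - 1 else h + 1"
  have "(\<Sum>x\<in>U. if x \<in> B then - 1 else 1 :: int) = (\<Sum>x\<in>U. if x \<in> B - {u} then - 1 else 1)"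
    using u by (intro sum.cong) auto
  then have sum: "?h + (\<Sum>x\<in>U. if x \<in> B - {u} then - 1 else 1) = 0"
    using insert.prems(2) u insert.hyps(1) by auto
  have B: "B - {u} \<subseteq> U" using insert by auto
  have here: "star_level h (insert u U) B u = (if U - B \<noteq> {} then h else h - 1)"
  proof -
    have none: "{x \<in> insert u U. x < u} = {}" using insert.hyps by (auto dest: order.strict_trans)
    have "(\<exists>x\<in>insert u U - B. u < x) \<longleftrightarrow> U - B \<noteq> {}" using insert.hyps by auto
    then show ?thesis unfolding star_level_def level_def none by simp
  qed
  show ?case
  proof (cases "u \<in> B \<and> (if U - B \<noteq> {} then h else h - 1) = 0")
    case True
    then show ?thesis using here by metis
  next
    case False
    \<comment> \<open>Leaving the range allowed by this condition would take a down step at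
      \<open>u\<close> with starred height 0, which \<open>False\<close> excludes.\<close>
    have "?h \<ge> 1 \<or> ?h = 0 \<and> U - (B - {u}) \<noteq> {}"
      using False insert.prems(3) u by (auto split: if_splits)
    then obtain b where "b \<in> B - {u}" "star_level ?h U (B - {u}) b = 0"
      using insert.IH[OF B sum] by blast
    then show ?thesis
      using star_level_insert_least[of U u b h B] insert.hyps B by auto
  qed
qed

text \<open>Supplying the missing factor as \<open>1 = x b - (x b - 1)\<close> turns the summand at
  \<open>b\<close> into a difference of neighbouring mixed products.\<close>

lemma sum_prod_telescope:
  fixes x :: "'a::linorder \<Rightarrow> 'b::comm_ring_1"
  assumes "finite B"
  shows "(\<Sum>b\<in>B. \<Prod>c\<in>B - {b}. if c < b then x c - 1 else x c) = (\<Prod>b\<in>B. x b) - (\<Prod>b\<in>B. x b - 1)"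
  using assms
proof (induction B rule: finite_linorder_max_induct)
  case empty
  then show ?case by simp
next
  case (insert m B)
  have m: "m \<notin> B" using insert by auto
  have "(\<Prod>c\<in>insert m B - {b}. if c < b then x c - 1 else x c)
      = x m * (\<Prod>c\<in>B - {b}. if c < b then x c - 1 else x c)" if "b \<in> B" for b
  proof -
    have "insert m B - {b} = insert m (B - {b})" "\<not> m < b"
      using that m insert.hyps by auto
    then show ?thesis using m insert.hyps by simp
  qed
  moreover have "(\<Prod>c\<in>insert m B - {m}. if c < m then x c - 1 else x c) = (\<Prod>c\<in>B. x c - 1)"
    using m insert.hyps by (intro prod.cong) auto
  ultimately have "(\<Sum>b\<in>insert m B. \<Prod>c\<in>insert m B - {b}. if c < b then x c - 1 else x c)
      = (\<Prod>c\<in>B. x c - 1) + x m * (\<Sum>b\<in>B. \<Prod>c\<in>B - {b}. if c < b then x c - 1 else x c)"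
    using m insert.hyps by (simp add: sum_distrib_left)
  then show ?case
    using m insert by (simp add: algebra_simps)
qed

lemma sum_signs_zero:
  assumes "finite U" "B \<subseteq> U" "card U = 2 * card B"
  shows "(\<Sum>u\<in>U. if u \<in> B then - 1 else 1 :: int) = 0"
proof -
  have "U \<inter> B = B" "U \<inter> - B = U - B" using assms by auto
  moreover have "card (U - B) = card B"
    using assms by (simp add: card_Diff_subset finite_subset)
  ultimately show ?thesis
    using assms by (simp add: sum.If_cases finite_subset)
qed

section \<open>The recursion for the product of starred heights\<close>

text \<open>This is the recursion of \<open>crossout_count_rec\<close> without the factor
  \<open>card U - 1\<close>. The cases are whether the least position is a down step.\<close>

lemma prod_star_level_rec:
  assumes U: "finite U" "B \<subseteq> U" "card U = 2 * card B" "B \<noteq> {}"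
  shows "(\<Prod>b\<in>B. star_level 1 U B b) =
    (\<Sum>b\<in>B. if Min (U - {b}) \<in> B then 0
          else \<Prod>c\<in>B - {b}. star_level 1 (U - {b, Min (U - {b})}) (B - {b}) c)"
    (is "_ = (\<Sum>b\<in>B. ?f b)")
proof -
  define m where "m = Min U"
  define V where "V = U - {m}"
  have finB: "finite B" using U finite_subset by auto
  have mU: "m \<in> U" using U by (auto simp: m_def intro!: Min_in)
  have V: "finite V" "U = insert m V" "m \<notin> V" "\<And>x. x \<in> V \<Longrightarrow> m < x"
    using U(1) mU Min_le[of U] by (auto simp: V_def m_def order.not_eq_order_implies_strict)
  have UB: "U - B \<noteq> {}"
    using U finB by (metis Diff_eq_empty_iff card_0_eq mult_2 add_eq_self_zero subset_antisym)
  have Min_eq: "Min (U - {b}) = m" if "b \<noteq> m" for b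
    using U(1) mU that V by (intro Min_eqI) (auto intro: less_imp_le)
  show ?thesis
  proof (cases "m \<in> B")
    case False
    \<comment> \<open>Removing the up step at \<open>m\<close> lowers every height by 1, and
      removing the down step at \<open>b\<close> restores those after \<open>b\<close>.\<close>
    have f: "?f b = (\<Prod>c\<in>B - {b}. if c < b then star_level 1 U B c - 1 else star_level 1 U B c)"
      if b: "b \<in> B" for b
    proof -
      have bm: "b \<noteq> m" "b \<in> V" using b False U V by auto
      have "star_level 1 (U - {b, m}) (B - {b}) c
          = (if c < b then star_level 1 U B c - 1 else star_level 1 U B c)" if c: "c \<in> B - {b}" for c
      proof -
        have "U - {b, m} = V - {b}" using V by auto
        then have "star_level 1 (U - {b, m}) (B - {b}) c
            = star_level 1 V B c + (if b < c then 1 else 0)"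
          using star_level_remove_down[of V b B c 1] V b bm c by auto
        moreover have "star_level 1 U B c = star_level 2 V B c"
          using star_level_insert_least[of V m c 1 B] V False c U by auto
        moreover have "star_level 2 V B c = star_level 1 V B c + 1"
          using star_level_shift[of 1 1 V B c] by simp
        ultimately show ?thesis using c by auto
      qed
      then show ?thesis
        using bm False Min_eq by simp
    qed
    \<comment> \<open>Starting at height 0 instead of 1 subtracts 1 from each starred height, so a
      zero here is a vanishing factor \<open>star_level 1 U B b - 1\<close>.\<close>
    have "\<exists>b\<in>B. star_level 0 U B b = 0"
      using U UB sum_signs_zero[OF U(1-3)] by (intro exists_star_level_zero) auto
    then have "(\<Prod>b\<in>B. star_level 1 U B b - 1) = 0"
      using finB star_level_shift[of 0 1 U B] by (intro prod_zero) auto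
    then show ?thesis
      using sum_prod_telescope[OF finB, of "star_level 1 U B"] f by simp
  next
    case True
    define a where "a = Min V"
    have "V \<noteq> {}" using UB True V by auto
    then have aV: "a \<in> V" using V by (auto simp: a_def intro!: Min_in)
    have ma: "m < a" using V aV by auto
    have a_le: "a \<le> x" if "x \<in> V" for x using V that by (auto simp: a_def)
    have "(\<Sum>b\<in>B. ?f b) = ?f m + (\<Sum>b\<in>B - {m}. ?f b)"
      using True finB by (simp add: sum.remove)
    \<comment> \<open>For \<open>b\<close> other than \<open>m\<close>, the mark A would fall on
      \<open>m\<close>, which lies in \<open>B\<close>.\<close>
    also have "(\<Sum>b\<in>B - {m}. ?f b) = 0"
      using True Min_eq by (intro sum.neutral) auto
    also have "?f m + 0 = (\<Prod>b\<in>B. star_level 1 U B b)"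
    proof (cases "a \<in> B")
      \<comment> \<open>Two initial down steps lead from height 1 below the axis: the second leaves
        from 0 with an up step still to come, so both sides vanish.\<close>
      case aB: True
      have "{u \<in> U. u < a} = {m}"
        using V ma a_le by (auto simp: not_less[symmetric])
      then have "level 1 U B a = 0"
        using True by (simp add: level_def)
      moreover obtain u where "u \<in> U - B" using UB by auto
      then have "u \<in> U - B" "a < u"
        using V True aB a_le[of u] by (auto simp: order.order_iff_strict)
      ultimately have "star_level 1 U B a = 0"
        by (auto simp: star_level_def)
      then have "(\<Prod>b\<in>B. star_level 1 U B b) = 0"
        using finB aB by (intro prod_zero) auto
      then show ?thesis
        using aB by (simp add: a_def V_def)
    next
      case aB: False
      define W where "W = V - {a}"
      have W: "finite W" "V = insert a W" "\<And>x. x \<in> W \<Longrightarrow> a < x" "U - {m, a} = W"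
        using V aV a_le by (auto simp: W_def order.order_iff_strict)
      have "{u \<in> U. u < m} = {}" using V by (auto dest: order.strict_trans)
      then have "level 1 U B m = 1" by (simp only: level_def) simp
      \<comment> \<open>The up step at \<open>a\<close> keeps the star from subtracting 1, so
        \<open>m\<close> contributes the factor 1. The pair \<open>m\<close>, \<open>a\<close> is
        then a down step followed by an up step, whose removal changes no other height.\<close>
      then have m1: "star_level 1 U B m = 1"
        using aB aV ma V(2) by (auto simp: star_level_def)
      have "star_level 1 U B c = star_level 1 W (B - {m}) c" if c: "c \<in> B - {m}" for c
      proof -
        have cW: "c \<in> V" "c \<in> W" using c U V W aB by auto
        have "star_level 1 U B c = star_level 0 V (B - {m}) c"
          using star_level_insert_least[of V m c 1 B] V True cW by simp
        also have "\<dots> = star_level 1 W (B - {m} - {a}) c"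
          using star_level_insert_least[of W a c 0 "B - {m}"] W aB cW by simp
        also have "B - {m} - {a} = B - {m}" using aB by auto
        finally show ?thesis .
      qed
      then have "(\<Prod>c\<in>B - {m}. star_level 1 U B c) = (\<Prod>c\<in>B - {m}. star_level 1 W (B - {m}) c)"
        by (intro prod.cong) auto
      then show ?thesis
        using aB W(4) m1 True finB by (simp add: prod.remove[of B m] flip: V_def a_def)
    qed
    finally show ?thesis by simp
  qed
qed

text \<open>Both sides obey the same recursion; each round removes one down step and one up step,
  and its factor \<open>card U - 1\<close> is the next odd number
  \<open>2 * card B - 1\<close>.\<close>

lemma crossout_count_eq:
  assumes "finite U" "B \<subseteq> U" "card U = 2 * card B"
  shows "int (crossout_count U B)
    = (\<Prod>i=1..card B. 2 * int i - 1) * (\<Prod>b\<in>B. star_level 1 U B b)"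
  using assms
proof (induction "card B" arbitrary: U B)
  case 0
  then have "U = {}" "B = {}" by auto
  moreover have "{xs. xs = [] \<and> crossout_list xs = {}} = {[]}" by auto
  ultimately show ?case by (simp add: crossout_count_def)
next
  case (Suc m)
  have finB: "finite B" using Suc finite_subset by auto
  have ne: "B \<noteq> {}" using Suc by auto
  let ?a = "\<lambda>b. Min (U - {b})"
  let ?V = "\<lambda>b. U - {b, ?a b}"
  let ?P = "(\<Prod>i=1..m. 2 * int i - 1)"
  have IH: "int (crossout_count (?V b) (B - {b})) = ?P * (\<Prod>c\<in>B - {b}. star_level 1 (?V b) (B - {b}) c)"
    if b: "b \<in> B" "?a b \<notin> B" for b
  proof -
    have cB: "card (B - {b}) = m" using b finB Suc(2) by simp
    have "U - {b} \<noteq> {}"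
    proof
      assume "U - {b} = {}"
      then have "card U \<le> card {b}" by (intro card_mono) auto
      then show False using Suc by simp
    qed
    then have "?a b \<in> U - {b}" using Suc by (intro Min_in) auto
    then have "card (?V b) = card U - card {b, ?a b}" "card {b, ?a b} = 2"
      using b Suc by (auto intro!: card_Diff_subset)
    then have "card (?V b) = 2 * card (B - {b})" using cB Suc by simp
    moreover have "B - {b} \<subseteq> ?V b" using Suc b by auto
    ultimately show ?thesis
      using Suc(1)[of "B - {b}" "?V b"] cB Suc by simp
  qed
  have "int (crossout_count U B) = (2 * int (Suc m) - 1)
      * (\<Sum>b\<in>B. int (if ?a b \<in> B then 0 else crossout_count (?V b) (B - {b})))"
    using Suc.prems Suc.hyps(2) by (subst crossout_count_rec) (simp_all add: of_nat_diff)
  also have "(\<Sum>b\<in>B. int (if ?a b \<in> B then 0 else crossout_count (?V b) (B - {b})))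
      = ?P * (\<Sum>b\<in>B. if ?a b \<in> B then 0 else \<Prod>c\<in>B - {b}. star_level 1 (?V b) (B - {b}) c)"
    unfolding sum_distrib_left by (intro sum.cong refl) (simp add: IH)
  also have "\<dots> = ?P * (\<Prod>b\<in>B. star_level 1 U B b)"
    using prod_star_level_rec[OF Suc.prems ne] by simp
  finally show ?case
    using Suc(2)[symmetric] by (simp add: prod.nat_ivl_Suc')
qed

section \<open>From permutations and paths to lists and sets\<close>

text \<open>Listing positions by increasing value is the one-line notation of \<open>inv w\<close>,
  which gives a bijection from permutations to orders.\<close>

lemma card_permutes_B_set:
  "card {w. w permutes {1..2 * n} \<and> B_set n w = B} = crossout_count {1..2 * n} B"
proof -
  let ?U = "{1..2 * n}"
  let ?F = "\<lambda>w. map (inv w) [1..<2 * n + 1]"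
  have setU: "set [1..<2 * n + 1] = ?U" by auto
  have sub: "?F ` {w. w permutes ?U} \<subseteq> permutations_of_set ?U"
  proof (intro image_subsetI)
    fix w assume "w \<in> {w. w permutes ?U}"
    then have "inv w permutes ?U" by (simp add: permutes_inv)
    then show "?F w \<in> permutations_of_set ?U"
      using setU by (auto simp: permutations_of_set_def distinct_map permutes_image permutes_inj_on
          simp del: upt_Suc)
  qed
  have inj: "inj_on ?F {w. w permutes ?U}"
  proof (rule inj_onI)
    fix v w assume "v \<in> {w. w permutes ?U}" "w \<in> {w. w permutes ?U}" and eq: "?F v = ?F w"
    then have vw: "v permutes ?U" "w permutes ?U" by auto
    have "inv v x = inv w x" for x
    proof (cases "x \<in> ?U")
      case True
      then show ?thesis using eq setU by (metis map_eq_conv)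
    next
      case False
      then show ?thesis using vw by (metis permutes_inv permutes_not_in)
    qed
    then show "v = w" using vw by (metis ext permutes_inv_inv)
  qed
  \<comment> \<open>An injection between sets of equal size \<open>(2 * n)!\<close> is onto.\<close>
  have img: "?F ` {w. w permutes ?U} = permutations_of_set ?U"
    using sub inj by (intro card_subset_eq) (auto simp: card_image card_permutations)
  have B: "B_set n w = crossout_list (?F w)" if w: "w permutes ?U" for w
  proof -
    have "sorted_wrt (\<lambda>x y. w x < w y) (?F w)"
      using w by (simp add: sorted_wrt_map permutes_inverses sorted_wrt_upt del: upt_Suc)
    moreover have "distinct (?F w)" "set (?F w) = ?U"
      using sub w by (auto simp: permutations_of_set_def image_subset_iff simp del: upt_Suc set_map)
    ultimately show ?thesis
      using crossout_B_eq_crossout_list[of w "?F w"] by (simp add: B_set_def del: upt_Suc set_map)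
  qed
  have "?F ` {w. w permutes ?U \<and> B_set n w = B}
      = {xs \<in> permutations_of_set ?U. crossout_list xs = B}"
    unfolding img[symmetric] using B by (auto simp del: upt_Suc)
  moreover have "inj_on ?F {w. w permutes ?U \<and> B_set n w = B}"
    using inj by (rule inj_on_subset) auto
  ultimately show ?thesis
    unfolding crossout_count_def using card_image[of ?F "{w. w permutes ?U \<and> B_set n w = B}"] by argo
qed

section \<open>Paths and their sets of down steps\<close>

lemma crossout_B_subset: "crossout_B w U \<subseteq> U"
proof (induction w U rule: crossout_B.induct)
  case (1 w U)
  show ?case
  proof (cases "finite U \<and> U \<noteq> {}")
    case True
    then have "arg_min_on w U \<in> U" by (simp add: arg_min_if_finite)
    then show ?thesis
      using 1[OF True refl refl] True by (subst crossout_B.simps) (auto simp: Let_def)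
  qed (subst crossout_B.simps; auto)
qed

lemma path_of_downs_down_positions: "path_of_downs (length p) (down_positions p) = p"
proof (rule nth_equalityI)
  fix i assume "i < length (path_of_downs (length p) (down_positions p))"
  then show "path_of_downs (length p) (down_positions p) ! i = p ! i"
    by (cases "p ! i") (auto simp: path_of_downs_def down_positions_def simp del: upt_Suc)
qed simp

theorem theorem4:
  fixes n :: nat and \<beta> :: "step list"
  assumes "n \<ge> 1" and "dyck_path (n + 1) \<beta>"
  shows "int (card {w. w permutes {1..2 * n} \<and> p_B n w = \<beta>})
           = (\<Prod>i=1..n. 2 * int i - 1) * (\<Prod>i=1..n. down_height_star \<beta> i)"
proof -
  define U where "U = {1..2 * n}"
  \<comment> \<open>List index \<open>b\<close> is the step ending at \<open>b + 1\<close>, so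
    \<open>B\<close> already carries the shift built into \<open>p_B\<close>. The indices 0 and
    \<open>2 * n + 1\<close>, outside \<open>U\<close>, are the forced first up step and last down
    step.\<close>
  define B where "B = {b \<in> U. \<beta> ! b = Down}"
  have finB: "finite B" by (simp add: B_def U_def)
  have BU: "B \<subseteq> U" by (auto simp: B_def)
  have len: "length \<beta> = 2 * n + 2"
    and ge: "\<And>k. k \<le> 2 * n + 2 \<Longrightarrow> 0 \<le> path_height \<beta> k"
    and end0: "path_height \<beta> (2 * n + 2) = 0"
    using assms(2) by (auto simp: dyck_path_def)
  have first: "\<beta> ! 0 = Up"
    using ge[of 1] by (auto simp: path_height_def split: if_splits)
  have last: "\<beta> ! (2 * n + 1) = Down"
    using ge[of "2 * n + 1"] end0 by (auto simp: path_height_def split: if_splits intro: step.exhaust)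
  have step_iff: "\<beta> ! j = Up \<longleftrightarrow> j \<notin> B" if "j \<in> U" for j
    using that by (cases "\<beta> ! j") (auto simp: B_def)
  \<comment> \<open>The forced first up step is the starting height 1.\<close>
  have height: "path_height \<beta> k = level 1 U B k" if k: "1 \<le> k" "k \<le> 2 * n + 1" for k
  proof -
    have "{..<k} = insert 0 {u \<in> U. u < k}" "0 \<notin> U"
      using k by (auto simp: U_def)
    then have "path_height \<beta> k = 1 + (\<Sum>j\<in>{u \<in> U. u < k}. if \<beta> ! j = Up then 1 else - 1)"
      using first by (simp add: path_height_def U_def)
    also have "(\<Sum>j\<in>{u \<in> U. u < k}. if \<beta> ! j = Up then 1 else - 1 :: int)
        = (\<Sum>j\<in>{u \<in> U. u < k}. if j \<in> B then - 1 else 1)"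
      using step_iff by (intro sum.cong) auto
    finally show ?thesis by (simp add: level_def)
  qed
  have cardB: "card B = n"
  proof -
    have "level 1 U B (2 * n + 1) = 1"
      using height[of "2 * n + 1"] end0 last by (simp add: path_height_def)
    moreover have "{u \<in> U. u < 2 * n + 1} = U" by (auto simp: U_def)
    ultimately have "(\<Sum>u\<in>U. if u \<in> B then - 1 else 1 :: int) = 0"
      by (simp add: level_def)
    moreover have "U \<inter> B = B" "U \<inter> - B = U - B" using BU by auto
    ultimately have "int (card (U - B)) = int (card B)"
      by (simp add: sum.If_cases U_def)
    moreover have "card (U - B) + card B = card U"
      using BU finB card_mono[OF _ BU] by (simp add: card_Diff_subset U_def)
    ultimately show ?thesis by (simp add: U_def)
  qed
  have downs: "down_positions \<beta> = insert (2 * n + 2) (Suc ` B)"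
  proof (intro equalityI subsetI)
    fix k assume "k \<in> down_positions \<beta>"
    then have k: "1 \<le> k" "k \<le> 2 * n + 2" "\<beta> ! (k - 1) = Down"
      using len by (auto simp: down_positions_def)
    then have "k \<noteq> 1" using first by auto
    then have "k = 2 * n + 2 \<or> k - 1 \<in> B \<and> k = Suc (k - 1)"
      using k by (auto simp: B_def U_def)
    then show "k \<in> insert (2 * n + 2) (Suc ` B)" by blast
  next
    fix k assume "k \<in> insert (2 * n + 2) (Suc ` B)"
    then show "k \<in> down_positions \<beta>"
      using len last by (auto simp: down_positions_def B_def U_def)
  qed
  have pB: "p_B n w = \<beta> \<longleftrightarrow> B_set n w = B" for w
  proof -
    have sub: "B_set n w \<subseteq> U"
      using crossout_B_subset by (simp add: B_set_def U_def)
    have pd: "p_B n w = path_of_downs (2 * n + 2) (insert (2 * n + 2) (Suc ` B_set n w))"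
      by (simp add: p_B_def)
    have "down_positions (p_B n w) = insert (2 * n + 2) (Suc ` B_set n w)"
      unfolding pd using sub by (intro down_positions_path_of_downs) (auto simp: U_def)
    moreover have "2 * n + 2 \<notin> Suc ` B_set n w" "2 * n + 2 \<notin> Suc ` B"
      using sub BU by (auto simp: U_def)
    ultimately have "p_B n w = \<beta> \<Longrightarrow> Suc ` B_set n w = Suc ` B"
      using downs by (metis insert_ident)
    moreover have "B_set n w = B \<Longrightarrow> p_B n w = \<beta>"
      using pd path_of_downs_down_positions[of \<beta>] downs len by simp
    ultimately show ?thesis
      by (auto simp: inj_image_eq_iff)
  qed
  \<comment> \<open>The last step is down, so any up step to the right of \<open>b\<close> lies
    within \<open>U\<close> and the two starring conditions agree.\<close>
  have star: "down_height_star \<beta> i = star_level 1 U B (down_pos \<beta> i - 1)"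
    if d: "down_pos \<beta> i \<in> Suc ` B" for i
  proof -
    obtain b where b: "b \<in> B" "down_pos \<beta> i = Suc b" using d by auto
    have bU: "1 \<le> b" "b \<le> 2 * n" using b BU by (auto simp: U_def)
    have "(\<exists>k\<in>{1..length \<beta>}. Suc b < k \<and> \<beta> ! (k - 1) = Up) \<longleftrightarrow> (\<exists>u\<in>U - B. b < u)"
    proof
      assume "\<exists>k\<in>{1..length \<beta>}. Suc b < k \<and> \<beta> ! (k - 1) = Up"
      then obtain k where k: "k \<le> 2 * n + 2" "Suc b < k" "\<beta> ! (k - 1) = Up"
        using len by auto
      then have "k \<noteq> 2 * n + 2" using last by auto
      then have "k - 1 \<in> U" using k by (auto simp: U_def)
      then show "\<exists>u\<in>U - B. b < u"
        using k step_iff by (intro bexI[of _ "k - 1"]) auto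
    next
      assume "\<exists>u\<in>U - B. b < u"
      then obtain u where "u \<in> U" "u \<notin> B" "b < u" by auto
      then show "\<exists>k\<in>{1..length \<beta>}. Suc b < k \<and> \<beta> ! (k - 1) = Up"
        using step_iff[of u] len by (intro bexI[of _ "Suc u"]) (auto simp: U_def)
    qed
    then show ?thesis
      using b bU height[of b] by (simp add: down_height_star_def down_height_def star_level_def)
  qed
  let ?ds = "sorted_list_of_set (Suc ` B)"
  have ds: "distinct ?ds" "set ?ds = Suc ` B" "length ?ds = n"
    using finB cardB by (auto simp: card_image)
  \<comment> \<open>The forced down step comes last, so the indices 1 to \<open>n\<close> in the
    product run exactly over \<open>Suc\<close> applied to \<open>B\<close>.\<close>
  have "sorted_list_of_set (down_positions \<beta>) = ?ds @ [2 * n + 2]"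
  proof (rule sorted_distinct_set_unique)
    show "sorted (?ds @ [2 * n + 2])" "distinct (?ds @ [2 * n + 2])"
      using finB BU by (auto simp: sorted_append U_def)
  qed (use downs finB in \<open>auto simp del: sorted_list_of_set_insert_remove\<close>)
  then have dpos: "down_pos \<beta> i = ?ds ! (i - 1)" if "i \<in> {1..n}" for i
    using that ds by (auto simp: down_pos_def nth_append)
  have "(\<Prod>i=1..n. down_height_star \<beta> i) = (\<Prod>i=1..n. star_level 1 U B (?ds ! (i - 1) - 1))"
  proof (intro prod.cong refl)
    fix i assume i: "i \<in> {1..n}"
    then have "?ds ! (i - 1) \<in> Suc ` B"
      using ds by (metis One_nat_def Suc_le_eq Suc_pred atLeastAtMost_iff nth_mem less_le_trans zero_less_one)
    then show "down_height_star \<beta> i = star_level 1 U B (?ds ! (i - 1) - 1)"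
      using star[of i] dpos[OF i] by simp
  qed
  also have "\<dots> = (\<Prod>j<n. star_level 1 U B (?ds ! j - 1))"
    by (rule prod.reindex_bij_witness[of _ Suc "\<lambda>i. i - 1"]) auto
  also have "\<dots> = (\<Prod>d\<in>Suc ` B. star_level 1 U B (d - 1))"
    using bij_betw_nth[OF ds(1), of "{..<n}" "Suc ` B"] ds
    by (intro prod.reindex_bij_betw) auto
  also have "\<dots> = (\<Prod>b\<in>B. star_level 1 U B b)"
    by (simp add: prod.reindex)
  finally have "(\<Prod>i=1..n. down_height_star \<beta> i) = (\<Prod>b\<in>B. star_level 1 U B b)" .
  moreover have "int (crossout_count U B)
      = (\<Prod>i=1..n. 2 * int i - 1) * (\<Prod>b\<in>B. star_level 1 U B b)"
    using crossout_count_eq[of U B] BU cardB by (simp add: U_def)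
  ultimately show ?thesis
    using card_permutes_B_set[of n B] by (simp add: pB U_def)
qed

end
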